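(* Let $d,h\ge 2$ be fixed. (i) If $T^h_d$ can be black pebbled with $p$ pebbles, then there are deterministic thrifty $k$-way branching programs with $O(k^p)$ states (as $k\to\infty$) solving $FT^h_d(k)$ and $BT^h_d(k)$. (ii) If $T^h_d$ can be fractionally pebbled with $p$ pebbles, then there are nondeterministic thrifty $k$-way branching programs with $O(k^p)$ states solving $BT^h_d(k)$.
   Context: $T^h_d$ is the balanced rooted $d$-ary tree with $h$ levels. An instance with parameter $k$ assigns to each internal node $i$ a function $f_i:[k]^d\to[k]$ (given by its $k^d$ values) and to each leaf an element of $[k]=\{1,\dots,k\}$; $v_i$ is the leaf label for a leaf and $v_i=f_i(v_{j_1},\dots,v_{j_d})$ for an internal node with children $j_1,\dots,j_d$. $FT^h_d(k)$: output the root value; $BT^h_d(k)$: decide whether the root value is $1$. The $k$-ary input variables are $f_i(x)$ (internal $i$, $x\in[k]^d$) and one per leaf. Branching programs: a nondeterministic $k$-way branching program computing $g:[k]^m\to R$ is a directed rooted multigraph of states, edges labelled by elements of $[k]$, nonfinal states labelled by variable indices, $|R|$ final sink states labelled by elements of $R$; on input $x$, edges labelled $x_j$ out of states labelled $j$ are activated; each computation (path of activated edges from the root) is infinite, ends in the final state labelled $g(x)$, or aborts, and at least one ends in a final state. Deterministic: every nonfinal state has exactly $k$ outedges labelled $1,\dots,k$. A deterministic program for these problems is thrifty if on every input every query to a variable $f_i(x)$ of an internal node has $x$ equal to the tuple of correct values of the children of $i$; a nondeterministic one is thrifty if this holds along every computation ending in a final state. Pebbling: a fractional configuration assigns to each node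 $i$ reals $b(i),w(i)\ge 0$ with $b(i)+w(i)\le1$; the number of pebbles is $\sum_i(b(i)+w(i))$. Moves: (i) decrease any $b(i)$; (ii) increase any $w(i)$; (iii) if all children of $i$ have $b+w=1$ (vacuous for leaves), set $w(i)=0$, increase $b(i)$, and simultaneously decrease black values of the children of $i$. A fractional pebbling with $p$ pebbles starts and ends with all values $0$, has the root with black value $1$ at some point, and never exceeds $p$ pebbles. A black pebbling is a fractional pebbling in which always $w(i)=0$ and $b(i)\in\{0,1\}$. *)

theory Defs
  imports
    Complex_Main
    "HOL-Library.FuncSet"
    "HOL-Library.Landau_Symbols"
    "Graph_Theory.Digraph"
    "Graph_Theory.Arc_Walk"
begin

section \<open>The balanced tree and the tree evaluation functions\<close>

text \<open>
  A node is the list of child indices (each below \<open>d\<close>) on the way down from the root \<open>[]\<close>.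
  The tree has \<open>h\<close> levels, so the leaves are the nodes of length \<open>h - 1\<close>.
\<close>

type_synonym node = "nat list"

definition nodes :: "nat \<Rightarrow> nat \<Rightarrow> node set" where
  "nodes d h = {i. length i < h \<and> set i \<subseteq> {..<d}}"

definition internal :: "nat \<Rightarrow> node \<Rightarrow> bool" where
  "internal h i \<longleftrightarrow> Suc (length i) < h"

definition children :: "nat \<Rightarrow> nat \<Rightarrow> node \<Rightarrow> node list" where
  "children d h i = (if internal h i then map (\<lambda>j. i @ [j]) [0..<d] else [])"

text \<open>The input variables: \<open>FunVar i xs\<close> is \<open>f\<^sub>i(xs)\<close>, and \<open>LeafVar i\<close> is the label of the leaf \<open>i\<close>.\<close>

datatype tree_var = LeafVar node | FunVar node "nat list"

definition tree_vars :: "nat \<Rightarrow> nat \<Rightarrow> nat \<Rightarrow> tree_var set" where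
  "tree_vars d h k =
     {LeafVar i | i. i \<in> nodes d h \<and> \<not> internal h i} \<union>
     {FunVar i xs | i xs. i \<in> nodes d h \<and> internal h i \<and> length xs = d \<and> set xs \<subseteq> {1..k}}"

function node_val :: "nat \<Rightarrow> nat \<Rightarrow> (tree_var \<Rightarrow> nat) \<Rightarrow> node \<Rightarrow> nat" where
  "node_val d h x i =
     (if internal h i then x (FunVar i (map (node_val d h x) (children d h i)))
      else x (LeafVar i))"
  by pat_completeness auto
termination
  by (relation "measure (\<lambda>(d, h, x, i). h - length i)") (auto simp: children_def internal_def)

declare node_val.simps [simp del]

definition FT :: "nat \<Rightarrow> nat \<Rightarrow> (tree_var \<Rightarrow> nat) \<Rightarrow> nat" where
  "FT d h x = node_val d h x []"

definition BT :: "nat \<Rightarrow> nat \<Rightarrow> (tree_var \<Rightarrow> nat) \<Rightarrow> bool" where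
  "BT d h x \<longleftrightarrow> node_val d h x [] = 1"


section \<open>Branching programs\<close>

text \<open>
  The type variables stand for states, edges, variable indices and output values.
  \<open>bp_query\<close> is the variable index labelling a nonfinal state, \<open>bp_out\<close> the value labelling a
  final state; each is irrelevant on the other kind of state.
\<close>

record ('s, 'e, 'v, 'r) bprog =
  bp_graph :: "('s, 'e) pre_digraph"
  bp_root :: 's
  bp_final :: "'s set"
  bp_query :: "'s \<Rightarrow> 'v"
  bp_out :: "'s \<Rightarrow> 'r"
  bp_label :: "'e \<Rightarrow> nat"

abbreviation bp_states :: "('s, 'e, 'v, 'r) bprog \<Rightarrow> 's set" where
  "bp_states B \<equiv> verts (bp_graph B)"

definition branching_program ::
    "nat \<Rightarrow> 'v set \<Rightarrow> 'r set \<Rightarrow> ('s, 'e, 'v, 'r) bprog \<Rightarrow> bool" where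
  "branching_program k V R B \<longleftrightarrow>
     fin_digraph (bp_graph B) \<and>
     bp_root B \<in> bp_states B \<and>
     (\<forall>e \<in> arcs (bp_graph B). bp_label B e \<in> {1..k}) \<and>
     bp_final B \<subseteq> bp_states B \<and>
     bij_betw (bp_out B) (bp_final B) R \<and>
     (\<forall>s \<in> bp_final B. out_arcs (bp_graph B) s = {}) \<and>
     (\<forall>s \<in> bp_states B - bp_final B. bp_query B s \<in> V)"

definition deterministic :: "nat \<Rightarrow> ('s, 'e, 'v, 'r) bprog \<Rightarrow> bool" where
  "deterministic k B \<longleftrightarrow>
     (\<forall>s \<in> bp_states B - bp_final B. bij_betw (bp_label B) (out_arcs (bp_graph B) s) {1..k})"

definition inputs :: "nat \<Rightarrow> 'v set \<Rightarrow> ('v \<Rightarrow> nat) set" where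
  "inputs k V = V \<rightarrow>\<^sub>E {1..k}"

definition activated :: "('s, 'e, 'v, 'r) bprog \<Rightarrow> ('v \<Rightarrow> nat) \<Rightarrow> ('s, 'e) pre_digraph" where
  "activated B x = (bp_graph B)
     \<lparr> arcs := {e \<in> arcs (bp_graph B). bp_label B e = x (bp_query B (tail (bp_graph B) e))} \<rparr>"

text \<open>
  A walk of activated edges from the root to \<open>s\<close>. If \<open>s\<close> is final, it is a complete
  computation, as final states are sinks; the other computations are infinite or abort.
\<close>

definition bp_walk ::
    "('s, 'e, 'v, 'r) bprog \<Rightarrow> ('v \<Rightarrow> nat) \<Rightarrow> 'e list \<Rightarrow> 's \<Rightarrow> bool" where
  "bp_walk B x p s \<longleftrightarrow> pre_digraph.awalk (activated B x) (bp_root B) p s"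

definition computes ::
    "nat \<Rightarrow> 'v set \<Rightarrow> 'r set \<Rightarrow> (('v \<Rightarrow> nat) \<Rightarrow> 'r) \<Rightarrow> ('s, 'e, 'v, 'r) bprog \<Rightarrow> bool" where
  "computes k V R g B \<longleftrightarrow>
     branching_program k V R B \<and>
     (\<forall>x \<in> inputs k V.
        (\<forall>p. \<forall>s \<in> bp_final B. bp_walk B x p s \<longrightarrow> bp_out B s = g x) \<and>
        (\<exists>p. \<exists>s \<in> bp_final B. bp_walk B x p s))"

definition thrifty_query :: "nat \<Rightarrow> nat \<Rightarrow> (tree_var \<Rightarrow> nat) \<Rightarrow> tree_var \<Rightarrow> bool" where
  "thrifty_query d h x v \<longleftrightarrow>
     (\<forall>i ys. v = FunVar i ys \<longrightarrow> ys = map (node_val d h x) (children d h i))"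

text \<open>For the deterministic notion, every nonfinal state reached on an input makes a query on it.\<close>

definition det_thrifty ::
    "nat \<Rightarrow> nat \<Rightarrow> nat \<Rightarrow> ('s, 'e, tree_var, 'r) bprog \<Rightarrow> bool" where
  "det_thrifty d h k B \<longleftrightarrow>
     (\<forall>x \<in> inputs k (tree_vars d h k). \<forall>p. \<forall>s \<in> bp_states B - bp_final B.
        bp_walk B x p s \<longrightarrow> thrifty_query d h x (bp_query B s))"

definition nondet_thrifty ::
    "nat \<Rightarrow> nat \<Rightarrow> nat \<Rightarrow> ('s, 'e, tree_var, 'r) bprog \<Rightarrow> bool" where
  "nondet_thrifty d h k B \<longleftrightarrow>
     (\<forall>x \<in> inputs k (tree_vars d h k). \<forall>p. \<forall>t \<in> bp_final B. bp_walk B x p t \<longrightarrow>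
        (\<forall>s \<in> set (pre_digraph.awalk_verts (bp_graph B) (bp_root B) p) - bp_final B.
           thrifty_query d h x (bp_query B s)))"


section \<open>Pebbling\<close>

text \<open>Black and white values of the nodes; only the values on the nodes of the tree matter.\<close>

type_synonym config = "(node \<Rightarrow> real) \<times> (node \<Rightarrow> real)"

definition valid_config :: "nat \<Rightarrow> nat \<Rightarrow> config \<Rightarrow> bool" where
  "valid_config d h = (\<lambda>(b, w). \<forall>i \<in> nodes d h. b i \<ge> 0 \<and> w i \<ge> 0 \<and> b i + w i \<le> 1)"

definition empty_config :: "nat \<Rightarrow> nat \<Rightarrow> config \<Rightarrow> bool" where
  "empty_config d h = (\<lambda>(b, w). \<forall>i \<in> nodes d h. b i = 0 \<and> w i = 0)"

definition pebbles :: "nat \<Rightarrow> nat \<Rightarrow> config \<Rightarrow> real" where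
  "pebbles d h = (\<lambda>(b, w). \<Sum>i \<in> nodes d h. b i + w i)"

text \<open>Increases and decreases may be by zero.\<close>

inductive pebble_move :: "nat \<Rightarrow> nat \<Rightarrow> config \<Rightarrow> config \<Rightarrow> bool" for d h where
  decrease_black:
    "i \<in> nodes d h \<Longrightarrow> r \<le> b i \<Longrightarrow> pebble_move d h (b, w) (b(i := r), w)"
| increase_white:
    "i \<in> nodes d h \<Longrightarrow> w i \<le> r \<Longrightarrow> pebble_move d h (b, w) (b, w(i := r))"
| place_black:
    "i \<in> nodes d h \<Longrightarrow>
     (\<And>c. c \<in> set (children d h i) \<Longrightarrow> b c + w c = 1) \<Longrightarrow>
     b i \<le> b' i \<Longrightarrow>
     (\<And>c. c \<in> set (children d h i) \<Longrightarrow> b' c \<le> b c) \<Longrightarrow>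
     (\<And>v. v \<noteq> i \<Longrightarrow> v \<notin> set (children d h i) \<Longrightarrow> b' v = b v) \<Longrightarrow>
     pebble_move d h (b, w) (b', w(i := 0))"

text \<open>The pebbling consists of the configurations \<open>C 0, \<dots>, C t\<close>.\<close>

definition fractional_pebbling ::
    "nat \<Rightarrow> nat \<Rightarrow> real \<Rightarrow> nat \<Rightarrow> (nat \<Rightarrow> config) \<Rightarrow> bool" where
  "fractional_pebbling d h p t C \<longleftrightarrow>
     (\<forall>n \<le> t. valid_config d h (C n) \<and> pebbles d h (C n) \<le> p) \<and>
     (\<forall>n < t. pebble_move d h (C n) (C (Suc n))) \<and>
     empty_config d h (C 0) \<and> empty_config d h (C t) \<and>
     (\<exists>n \<le> t. fst (C n) [] = 1)"

definition black_pebbling ::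
    "nat \<Rightarrow> nat \<Rightarrow> real \<Rightarrow> nat \<Rightarrow> (nat \<Rightarrow> config) \<Rightarrow> bool" where
  "black_pebbling d h p t C \<longleftrightarrow>
     fractional_pebbling d h p t C \<and>
     (\<forall>n \<le> t. \<forall>i \<in> nodes d h. snd (C n) i = 0 \<and> fst (C n) i \<in> {0, 1})"

end

theory Submission
  imports Defs
begin

text \<open>
  Follow the pebbling, one level of states per configuration. A black value \<open>b i\<close> stands for
  knowing in which block of about \<open>k\<^sup>1\<^sup>-\<^sup>b\<close> consecutive values \<open>v\<^sub>i\<close> lies, and a white value \<open>w i\<close>
  for a guess of \<open>v\<^sub>i\<close> modulo about \<open>k\<^sup>w\<close>. Block sizes and moduli are powers of 2, so that
  forgetting and further guessing are compatible with what is known, and so that block size and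
  modulus agree when \<open>b i + w i = 1\<close>, in which case the two together determine \<open>v\<^sub>i\<close>. Hence a move
  that places a pebble on \<open>i\<close> can query \<open>f\<^sub>i\<close> at the values of the children, check the guess about
  \<open>v\<^sub>i\<close> and record the new block; the other moves query a fixed leaf and ignore the answer.
  A configuration with \<open>p\<close> pebbles has \<open>O(k\<^sup>p)\<close> states.
\<close>

section \<open>Branching programs from transition relations\<close>

locale program =
  fixes k :: nat and V :: "'v set" and R :: "'r set" and S F :: "'s set" and r :: 's
    and q :: "'s \<Rightarrow> 'v" and out :: "'s \<Rightarrow> 'r" and \<delta> :: "'s \<Rightarrow> nat \<Rightarrow> 's \<Rightarrow> bool"
  assumes finite_S: "finite S" and r_in: "r \<in> S" and F_sub: "F \<subseteq> S"
    and q_in: "s \<in> S - F \<Longrightarrow> q s \<in> V"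
    and bij_out: "bij_betw out F R"
begin

text \<open>The final programs have natural numbers as states and edges for every \<open>k\<close>,
  so the finitely many abstract states are coded by an arbitrary injection.\<close>

definition enc :: "'s \<Rightarrow> nat" where
  "enc = (SOME f. inj_on f S)"

lemma inj_enc: "inj_on enc S"
  unfolding enc_def using finite_imp_inj_to_nat_seg[OF finite_S] by (metis someI_ex)

text \<open>Source, label and target are all stored in the edge, so parallel edges with different
  labels stay distinct and the graph can read its maps off the code.\<close>

definition edge :: "'s \<Rightarrow> nat \<Rightarrow> 's \<Rightarrow> nat" where
  "edge s l s' = prod_encode (enc s, prod_encode (l, enc s'))"

definition dec :: "nat \<Rightarrow> 's" where
  "dec = inv_into S enc"

definition prog_graph :: "(nat, nat) pre_digraph" where
  "prog_graph =
     \<lparr> verts = enc ` S,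
       arcs = {edge s l s' | s l s'. s \<in> S - F \<and> l \<in> {1..k} \<and> s' \<in> S \<and> \<delta> s l s'},
       tail = (\<lambda>e. fst (prod_decode e)),
       head = (\<lambda>e. snd (prod_decode (snd (prod_decode e)))) \<rparr>"

definition prog :: "(nat, nat, 'v, 'r) bprog" where
  "prog = \<lparr> bp_graph = prog_graph, bp_root = enc r, bp_final = enc ` F, bp_query = q \<circ> dec,
     bp_out = out \<circ> dec, bp_label = (\<lambda>e. fst (prod_decode (snd (prod_decode e)))) \<rparr>"

definition step :: "('v \<Rightarrow> nat) \<Rightarrow> 's \<Rightarrow> 's \<Rightarrow> bool" where
  "step x s s' \<longleftrightarrow> s \<in> S - F \<and> s' \<in> S \<and> \<delta> s (x (q s)) s'"

definition run :: "('v \<Rightarrow> nat) \<Rightarrow> (nat \<Rightarrow> 's) \<Rightarrow> nat \<Rightarrow> bool" where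
  "run x \<sigma> n \<longleftrightarrow> \<sigma> 0 = r \<and> (\<forall>i<n. step x (\<sigma> i) (\<sigma> (Suc i)))"

section \<open>Structure of the encoded program\<close>

lemma dec_enc [simp]: "s \<in> S \<Longrightarrow> dec (enc s) = s"
  unfolding dec_def using inj_enc by simp

lemma prog_simps [simp]:
  "bp_graph prog = prog_graph" "bp_root prog = enc r" "bp_final prog = enc ` F"
  "bp_query prog = q \<circ> dec" "bp_out prog = out \<circ> dec" "verts prog_graph = enc ` S"
  "tail prog_graph (edge s l s') = enc s" "head prog_graph (edge s l s') = enc s'"
  "bp_label prog (edge s l s') = l"
  by (simp_all add: prog_def prog_graph_def edge_def)

lemma arcs_prog:
  "arcs prog_graph = {edge s l s' | s l s'. s \<in> S - F \<and> l \<in> {1..k} \<and> s' \<in> S \<and> \<delta> s l s'}"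
  by (simp add: prog_graph_def)

lemma card_prog: "card (bp_states prog) = card S"
  using inj_enc by (simp add: card_image)

lemma enc_eq_iff [simp]: "s \<in> S \<Longrightarrow> s' \<in> S \<Longrightarrow> enc s = enc s' \<longleftrightarrow> s = s'"
  using inj_enc by (auto dest: inj_onD)

lemma enc_in_F [simp]: "s \<in> S \<Longrightarrow> enc s \<in> enc ` F \<longleftrightarrow> s \<in> F"
  using F_sub by auto

lemma out_arcs_prog:
  assumes "s \<in> S"
  shows "out_arcs prog_graph (enc s) = {edge s l s' | l s'. s \<notin> F \<and> l \<in> {1..k} \<and> s' \<in> S \<and> \<delta> s l s'}"
  using assms by (auto simp: out_arcs_def arcs_prog) blast

lemma branching_program_prog: "branching_program k V R prog"
proof -
  have "arcs prog_graph \<subseteq> (\<lambda>(s, l, s'). edge s l s') ` (S \<times> {1..k} \<times> S)"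
    by (force simp: arcs_prog)
  then have "finite (arcs prog_graph)"
    by (rule finite_subset) (use finite_S in auto)
  then have "fin_digraph (bp_graph prog)"
    using finite_S by unfold_locales (auto simp: arcs_prog)
  moreover have "bij_betw (out \<circ> dec) (enc ` F) R"
  proof (rule bij_betw_trans[OF _ bij_out])
    show "bij_betw dec (enc ` F) F"
      by (rule bij_betw_byWitness[where f' = enc]) (use F_sub in auto)
  qed
  ultimately show ?thesis
    unfolding branching_program_def using r_in F_sub q_in
    by (auto simp: arcs_prog out_arcs_prog subset_iff)
qed

section \<open>Walks of activated edges and runs of abstract states\<close>

lemma activated_simps [simp]:
  "tail (activated prog x) = tail prog_graph" "head (activated prog x) = head prog_graph"
  "verts (activated prog x) = enc ` S"
  by (simp_all add: activated_def)

lemma arcs_activated: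
  assumes "x \<in> inputs k V"
  shows "e \<in> arcs (activated prog x) \<longleftrightarrow> (\<exists>s s'. e = edge s (x (q s)) s' \<and> step x s s')"
proof -
  have "x (q s) \<in> {1..k}" if "s \<in> S - F" for s
    using q_in[OF that] assms by (auto simp: inputs_def)
  then show ?thesis
    by (fastforce simp: activated_def arcs_prog step_def)
qed

text \<open>Induction on the walk, for an arbitrary start state: each activated edge decodes to one
  step. The vertices are tracked too, because nondeterministic thriftiness speaks of them.\<close>

lemma awalk_imp_steps:
  assumes "x \<in> inputs k V" "pre_digraph.awalk (activated prog x) (enc a) p u" "a \<in> S"
  shows "\<exists>\<sigma>. \<sigma> 0 = a \<and> enc (\<sigma> (length p)) = u \<and> (\<forall>i<length p. step x (\<sigma> i) (\<sigma> (Suc i))) \<and>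
    set (pre_digraph.awalk_verts prog_graph (enc a) p) = (\<lambda>i. enc (\<sigma> i)) ` {..length p}"
  using assms(2,3)
proof (induction p arbitrary: a)
  case Nil
  then show ?case
    by (auto simp: pre_digraph.awalk_def pre_digraph.cas.simps pre_digraph.awalk_verts.simps)
next
  case (Cons e p)
  then obtain s b where e: "e = edge s (x (q s)) b" and st: "step x s b"
    using arcs_activated[OF assms(1)] by (auto simp: pre_digraph.awalk_def)
  have sa: "enc s = enc a"
    using Cons.prems by (simp add: pre_digraph.awalk_def pre_digraph.cas.simps e)
  then have [simp]: "s = a"
    using inj_enc st Cons.prems(2) by (auto simp: step_def dest: inj_onD)
  have b: "b \<in> S"
    using st by (simp add: step_def)
  have "pre_digraph.awalk (activated prog x) (enc b) p u"
    using Cons.prems b by (simp add: pre_digraph.awalk_def pre_digraph.cas.simps e)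
  from Cons.IH[OF this b] obtain \<sigma> where \<sigma>: "\<sigma> 0 = b" "enc (\<sigma> (length p)) = u"
    "\<forall>i<length p. step x (\<sigma> i) (\<sigma> (Suc i))"
    "set (pre_digraph.awalk_verts prog_graph (enc b) p) = (\<lambda>i. enc (\<sigma> i)) ` {..length p}"
    by blast
  show ?case
    by (rule exI[of _ "case_nat a \<sigma>"])
      (use \<sigma> st in \<open>auto simp: e pre_digraph.awalk_verts.simps atMost_Suc_eq_insert_0 image_image
        split: nat.split\<close>)
qed

lemma walk_imp_run:
  assumes "x \<in> inputs k V" "bp_walk prog x p u"
  shows "\<exists>\<sigma>. run x \<sigma> (length p) \<and> enc (\<sigma> (length p)) = u \<and>
    set (pre_digraph.awalk_verts prog_graph (enc r) p) = (\<lambda>i. enc (\<sigma> i)) ` {..length p}"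
  using awalk_imp_steps[of x r p u] assms r_in by (auto simp: bp_walk_def run_def)

lemma steps_imp_awalk:
  assumes "x \<in> inputs k V" "\<forall>i<n. step x (\<sigma> i) (\<sigma> (Suc i))" "\<sigma> 0 \<in> S"
  shows "\<exists>p. pre_digraph.awalk (activated prog x) (enc (\<sigma> 0)) p (enc (\<sigma> n))"
  using assms(2,3)
proof (induction n arbitrary: \<sigma>)
  case 0
  then show ?case
    by (auto simp: pre_digraph.awalk_def pre_digraph.cas.simps intro!: exI[of _ "[]"])
next
  case (Suc n)
  have st: "step x (\<sigma> 0) (\<sigma> 1)" and S1: "\<sigma> 1 \<in> S"
    using Suc.prems by (auto simp: step_def)
  obtain p where "pre_digraph.awalk (activated prog x) (enc (\<sigma> 1)) p (enc (\<sigma> (Suc n)))"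
    using Suc.IH[of "\<lambda>i. \<sigma> (Suc i)"] Suc.prems S1 by auto
  then have "pre_digraph.awalk (activated prog x) (enc (\<sigma> 0))
      (edge (\<sigma> 0) (x (q (\<sigma> 0))) (\<sigma> 1) # p) (enc (\<sigma> (Suc n)))"
    using st Suc.prems(2)
    by (auto simp: pre_digraph.awalk_def pre_digraph.cas.simps arcs_activated[OF assms(1)])
  then show ?case
    by blast
qed

lemma run_imp_walk:
  "x \<in> inputs k V \<Longrightarrow> run x \<sigma> n \<Longrightarrow> \<exists>p. bp_walk prog x p (enc (\<sigma> n))"
  using steps_imp_awalk[of x n \<sigma>] r_in by (auto simp: bp_walk_def run_def)

lemma run_in_S: "run x \<sigma> n \<Longrightarrow> i \<le> n \<Longrightarrow> \<sigma> i \<in> S"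
  using r_in by (cases i) (auto simp: run_def step_def)

section \<open>Correctness, determinism and thriftiness in terms of runs\<close>

lemma computes_prog:
  assumes "\<And>x \<sigma> n. x \<in> inputs k V \<Longrightarrow> run x \<sigma> n \<Longrightarrow> \<sigma> n \<in> F \<Longrightarrow> out (\<sigma> n) = g x"
    and "\<And>x. x \<in> inputs k V \<Longrightarrow> \<exists>\<sigma> n. run x \<sigma> n \<and> \<sigma> n \<in> F"
  shows "computes k V R g prog"
  unfolding computes_def
proof (intro conjI ballI allI impI branching_program_prog)
  fix x p u
  assume x: "x \<in> inputs k V" and u: "u \<in> bp_final prog" "bp_walk prog x p u"
  obtain \<sigma> where \<sigma>: "run x \<sigma> (length p)" "enc (\<sigma> (length p)) = u"
    using walk_imp_run[OF x u(2)] by blast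
  have "\<sigma> (length p) \<in> F"
    using u(1) run_in_S[OF \<sigma>(1) order.refl] by (simp flip: \<sigma>(2))
  then show "bp_out prog u = g x"
    using assms(1)[OF x \<sigma>(1)] run_in_S[OF \<sigma>(1) order.refl] by (simp flip: \<sigma>(2))
next
  fix x
  assume x: "x \<in> inputs k V"
  then obtain \<sigma> n where "run x \<sigma> n" "\<sigma> n \<in> F"
    using assms(2) by blast
  then show "\<exists>p. \<exists>s\<in>bp_final prog. bp_walk prog x p s"
    using run_imp_walk[OF x] by fastforce
qed

lemma deterministic_prog:
  assumes "\<And>s l. s \<in> S - F \<Longrightarrow> l \<in> {1..k} \<Longrightarrow> \<exists>!s'. s' \<in> S \<and> \<delta> s l s'"
  shows "deterministic k prog"
  unfolding deterministic_def
proof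
  fix u
  assume "u \<in> bp_states prog - bp_final prog"
  then obtain s where s: "u = enc s" "s \<in> S - F"
    by auto
  show "bij_betw (bp_label prog) (out_arcs (bp_graph prog) u) {1..k}"
    unfolding bij_betw_def
  proof
    show "inj_on (bp_label prog) (out_arcs (bp_graph prog) u)"
      using s assms[OF s(2)] by (auto simp: out_arcs_prog inj_on_def) blast
    show "bp_label prog ` out_arcs (bp_graph prog) u = {1..k}"
    proof (intro equalityI subsetI)
      fix l
      assume l: "l \<in> {1..k}"
      then obtain s' where "s' \<in> S" "\<delta> s l s'"
        using assms[OF s(2)] by blast
      then have "edge s l s' \<in> out_arcs (bp_graph prog) u"
        using s l by (auto simp: out_arcs_prog)
      then show "l \<in> bp_label prog ` out_arcs (bp_graph prog) u"
        by (metis image_eqI prog_simps(9))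
    qed (use s in \<open>auto simp: out_arcs_prog\<close>)
  qed
qed

text \<open>A walk into a final state decodes to a run ending in \<open>F\<close>. A nonfinal vertex
  on it cannot be the last one, so it is a state of the run at some index
  \<open>i < n\<close>.\<close>

lemma thrifty_prog:
  fixes thrifty :: "'v \<Rightarrow> bool"
  assumes "\<And>\<sigma> n i. run x \<sigma> n \<Longrightarrow> \<sigma> n \<in> F \<Longrightarrow> i < n \<Longrightarrow> thrifty (q (\<sigma> i))"
    and x: "x \<in> inputs k V" and w: "bp_walk prog x p u" "u \<in> bp_final prog"
    and v: "v \<in> set (pre_digraph.awalk_verts (bp_graph prog) (bp_root prog) p) - bp_final prog"
  shows "thrifty (bp_query prog v)"
proof -
  obtain \<sigma> where \<sigma>: "run x \<sigma> (length p)" "enc (\<sigma> (length p)) = u"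
    "set (pre_digraph.awalk_verts prog_graph (enc r) p) = (\<lambda>i. enc (\<sigma> i)) ` {..length p}"
    using walk_imp_run[OF x w(1)] by blast
  obtain i where i: "i \<le> length p" "v = enc (\<sigma> i)"
    using v \<sigma>(3) by auto
  have F: "\<sigma> (length p) \<in> F"
    using w(2) run_in_S[OF \<sigma>(1) order.refl] by (simp flip: \<sigma>(2))
  have "i \<noteq> length p"
    using i v \<sigma>(2) w(2) by auto
  then show ?thesis
    using assms(1)[OF \<sigma>(1) F] i run_in_S[OF \<sigma>(1)] by auto
qed

end

section \<open>Programs that follow a pebbling\<close>

lemma finite_nodes [simp]: "finite (nodes d h)"
proof -
  have "nodes d h \<subseteq> {xs. set xs \<subseteq> {..<d} \<and> length xs \<le> h}"
    by (auto simp: nodes_def)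
  then show ?thesis
    by (rule finite_subset) (rule finite_lists_length_le, simp)
qed

lemma childrenD:
  assumes "i \<in> nodes d h" "c \<in> set (children d h i)"
  shows "c \<in> nodes d h" "length c = Suc (length i)"
  using assms by (auto simp: nodes_def children_def internal_def split: if_splits)

lemma length_children: "internal h i \<Longrightarrow> length (children d h i) = d"
  by (simp add: children_def)

lemma node_val_in:
  assumes x: "x \<in> inputs k (tree_vars d h k)" and "i \<in> nodes d h"
  shows "node_val d h x i \<in> {1..k}"
  using assms(2)
proof (induction "h - length i" arbitrary: i rule: less_induct)
  case less
  have IH: "node_val d h x c \<in> {1..k}" if "c \<in> set (children d h i)" for c
    using less.hyps[of c] childrenD[OF less.prems that] by (auto simp: nodes_def)
  have x_in: "v \<in> tree_vars d h k \<Longrightarrow> x v \<in> {1..k}" for v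
    using x by (auto simp: inputs_def)
  show ?case
  proof (cases "internal h i")
    case True
    have "FunVar i (map (node_val d h x) (children d h i)) \<in> tree_vars d h k"
      using True less.prems IH by (auto simp: tree_vars_def length_children)
    then show ?thesis
      using True x_in by (simp add: node_val.simps[of d h x i])
  next
    case False
    then have "LeafVar i \<in> tree_vars d h k"
      using less.prems by (auto simp: tree_vars_def)
    then show ?thesis
      using False x_in by (simp add: node_val.simps[of d h x i])
  qed
qed

text \<open>For \<open>b > 0\<close>, the first element of the block of size \<open>b\<close> around
  \<open>v\<close> lies in the same block of size \<open>b'\<close> as \<open>v\<close>, since large
  blocks are unions of small ones. Thus knowledge can be coarsened without knowing
  \<open>v\<close>.\<close>

lemma div_mult_div: "(b::nat) dvd b' \<Longrightarrow> v div b * b div b' = v div b'"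
  by (cases "b = 0") (auto simp: dvd_def div_mult2_eq)

text \<open>
  A state \<open>(n, a, c, y)\<close> asserts for each node \<open>j\<close> that \<open>v\<^sub>j - 1\<close> lies in block number \<open>a j\<close> of size
  \<open>s n j\<close> and is congruent to \<open>c j\<close> modulo \<open>m n j\<close>. The move from level \<open>n\<close> to level \<open>n + 1\<close> places
  a black pebble on the node given by \<open>pl n\<close>, if any. At level \<open>n0\<close> the value of the root is known;
  from then on \<open>y\<close> is the output determined by it, before that it is a dummy.
\<close>

locale discrete_pebbling =
  fixes d h k t n0 :: nat and s m :: "nat \<Rightarrow> node \<Rightarrow> nat" and pl :: "nat \<Rightarrow> node option"
    and R :: "'r set" and G :: "nat \<Rightarrow> 'r"
  assumes d_pos: "d \<ge> 1" and h_pos: "h \<ge> 1" and k_pos: "k \<ge> 1" and n0_less: "n0 < t"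
    and m_pos: "m n j \<ge> 1"
    and first: "j \<in> nodes d h \<Longrightarrow> k \<le> s 0 j" "j \<in> nodes d h \<Longrightarrow> m 0 j = 1"
    and final: "j \<in> nodes d h \<Longrightarrow> k \<le> s t j" "j \<in> nodes d h \<Longrightarrow> m t j = 1"
    and root: "s n0 [] = 1"
    and refine: "n < t \<Longrightarrow> j \<in> nodes d h \<Longrightarrow> pl n \<noteq> Some j \<Longrightarrow> s n j dvd s (Suc n) j"
      "n < t \<Longrightarrow> j \<in> nodes d h \<Longrightarrow> pl n \<noteq> Some j \<Longrightarrow> m n j dvd m (Suc n) j"
    and place: "n < t \<Longrightarrow> pl n = Some i \<Longrightarrow> i \<in> nodes d h"
      "n < t \<Longrightarrow> pl n = Some i \<Longrightarrow> m (Suc n) i = 1"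
      "n < t \<Longrightarrow> pl n = Some i \<Longrightarrow> c \<in> set (children d h i) \<Longrightarrow> s n c = m n c"
    and finite_R: "finite R" and G_in: "v \<in> {1..k} \<Longrightarrow> G v \<in> R"
begin

definition level :: "nat \<Rightarrow> (nat \<times> (node \<Rightarrow> nat) \<times> (node \<Rightarrow> nat) \<times> 'r) set" where
  "level n = {n} \<times> (\<Pi>\<^sub>E j\<in>nodes d h. {..(k - 1) div s n j}) \<times> (\<Pi>\<^sub>E j\<in>nodes d h. {..<m n j}) \<times>
     (if n \<le> n0 then {G 1} else R)"

definition states :: "(nat \<times> (node \<Rightarrow> nat) \<times> (node \<Rightarrow> nat) \<times> 'r) set" where
  "states = (\<Union>n\<le>t. level n)"

definition start :: "nat \<times> (node \<Rightarrow> nat) \<times> (node \<Rightarrow> nat) \<times> 'r" where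
  "start = (0, (\<lambda>j\<in>nodes d h. 0), (\<lambda>j\<in>nodes d h. 0), G 1)"

text \<open>With equal block size and modulus, block start plus residue is the shifted value of a
  child. In the last block a wrong guess can exceed the range, and \<open>min k\<close> keeps the
  query a legal variable; for true assertions the sum is already at most \<open>k\<close>.\<close>

definition qry :: "nat \<times> (node \<Rightarrow> nat) \<times> (node \<Rightarrow> nat) \<times> 'r \<Rightarrow> tree_var" where
  "qry = (\<lambda>(n, a, c, y). case pl n of
     None \<Rightarrow> LeafVar (replicate (h - 1) 0)
   | Some i \<Rightarrow> if internal h i
       then FunVar i (map (\<lambda>j. min k (a j * s n j + c j + 1)) (children d h i))
       else LeafVar i)"

text \<open>For the placed node, the equation on \<open>c j\<close> checks the guess against the
  answer. For the others, the block is coarsened and the guess may be refined; the choice of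
  \<open>c'\<close> is the only source of nondeterminism. At level \<open>n0\<close> the root block
  has size 1, so \<open>a [] + 1\<close> is the root value.\<close>

definition trans_rel :: "nat \<times> (node \<Rightarrow> nat) \<times> (node \<Rightarrow> nat) \<times> 'r \<Rightarrow> nat \<Rightarrow>
    nat \<times> (node \<Rightarrow> nat) \<times> (node \<Rightarrow> nat) \<times> 'r \<Rightarrow> bool" where
  "trans_rel = (\<lambda>(n, a, c, y) l (n', a', c', y'). n' = Suc n \<and>
     (\<forall>j \<in> nodes d h. if pl n = Some j
        then c j = (l - 1) mod m n j \<and> a' j = (l - 1) div s n' j \<and> c' j = 0
        else a' j = a j * s n j div s n' j \<and> c' j mod m n j = c j) \<and>
     y' = (if n = n0 then G (a [] + 1) else y))"

section \<open>The state space and its size\<close>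

lemma fst_start [simp]: "fst start = 0"
  by (simp add: start_def)

lemma root_in [simp]: "[] \<in> nodes d h"
  using h_pos by (simp add: nodes_def)

lemma fst_level: "u \<in> level n \<Longrightarrow> fst u = n"
  by (auto simp: level_def)

lemma states_iff: "u \<in> states \<longleftrightarrow> fst u \<le> t \<and> u \<in> level (fst u)"
  by (auto simp: states_def dest: fst_level)

lemma final_iff: "u \<in> states \<Longrightarrow> u \<in> level t \<longleftrightarrow> fst u = t"
  by (auto simp: states_iff dest: fst_level)

lemma nonfinal: "u \<in> states - level t \<Longrightarrow> fst u < t \<and> u \<in> level (fst u)"
  using final_iff[of u] by (auto simp: states_iff)

lemma finite_level: "finite (level n)"
  using finite_R by (auto simp: level_def intro!: finite_cartesian_product finite_PiE)

lemma card_level: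
  "card (level n) = (\<Prod>j\<in>nodes d h. Suc ((k - 1) div s n j)) * (\<Prod>j\<in>nodes d h. m n j) *
     (if n \<le> n0 then 1 else card R)"
  by (simp add: level_def card_cartesian_product card_PiE)

lemma card_states: "card states \<le> (\<Sum>n\<le>t. card (level n))"
  unfolding states_def by (rule card_UN_le) simp

lemma k_div:
  assumes "j \<in> nodes d h"
  shows "(k - 1) div s 0 j = 0" "(k - 1) div s t j = 0"
  using first(1)[OF assms] final(1)[OF assms] k_pos by simp_all

text \<open>At level \<open>t\<close> each node has a single block and modulus 1, so a final state
  is determined by its output.\<close>

lemma bij_out: "bij_betw (\<lambda>u. snd (snd (snd u))) (level t) R"
proof -
  have "(\<Pi>\<^sub>E j\<in>nodes d h. {..(k - 1) div s t j}) = {\<lambda>j\<in>nodes d h. 0}"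
    "(\<Pi>\<^sub>E j\<in>nodes d h. {..<m t j}) = {\<lambda>j\<in>nodes d h. 0}"
    using final k_div by (auto simp: fun_eq_iff PiE_iff extensional_def)
  then show ?thesis
    using n0_less by (auto simp: level_def bij_betw_def inj_on_def image_iff)
qed

lemma leaf_in: "LeafVar (replicate (h - 1) 0) \<in> tree_vars d h k"
  using d_pos h_pos by (auto simp: tree_vars_def nodes_def internal_def)

lemma qry_in:
  assumes "u \<in> states - level t"
  shows "qry u \<in> tree_vars d h k"
proof -
  obtain n a c y where u: "u = (n, a, c, y)"
    by (cases u)
  have n: "n < t"
    using nonfinal[OF assms] by (simp add: u)
  show ?thesis
    using leaf_in place(1)[OF n] k_pos
    by (auto simp: qry_def u tree_vars_def length_children split: option.split)
qed

sublocale program k "tree_vars d h k" R states "level t" start qry "\<lambda>u. snd (snd (snd u))" trans_rel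
proof
  show "finite states"
    unfolding states_def using finite_level by blast
  show "start \<in> states"
    using m_pos first by (auto simp: start_def states_iff level_def)
  show "level t \<subseteq> states"
    by (auto simp: states_def)
qed (auto intro: qry_in bij_out)

definition val :: "(tree_var \<Rightarrow> nat) \<Rightarrow> node \<Rightarrow> nat" where
  "val x j = node_val d h x j - 1"

lemma val_le: "x \<in> inputs k (tree_vars d h k) \<Longrightarrow> j \<in> nodes d h \<Longrightarrow> val x j \<le> k - 1"
  using node_val_in[of x k d h j] by (auto simp: val_def)

lemma Suc_val:
  "x \<in> inputs k (tree_vars d h k) \<Longrightarrow> j \<in> nodes d h \<Longrightarrow> Suc (val x j) = node_val d h x j"
  using node_val_in[of x k d h j] by (simp add: val_def)

text \<open>Block size and modulus agree on every child, so quotient and remainder recover the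
  child's value and the query is made at the true tuple. For a leaf the assumption on children is
  vacuous.\<close>

lemma qry_correct:
  assumes x: "x \<in> inputs k (tree_vars d h k)" and n: "n < t" and i: "pl n = Some i"
    and ac: "\<And>j. j \<in> set (children d h i) \<Longrightarrow> a j = val x j div s n j \<and> c j = val x j mod m n j"
  shows "x (qry (n, a, c, y)) = node_val d h x i" "thrifty_query d h x (qry (n, a, c, y))"
proof -
  have "min k (a j * s n j + c j + 1) = node_val d h x j" if j: "j \<in> set (children d h i)" for j
  proof -
    have jn: "j \<in> nodes d h"
      using childrenD(1)[OF place(1)[OF n i] j] .
    have a: "a j = val x j div s n j" and c: "c j = val x j mod s n j"
      unfolding place(3)[OF n i j] using ac[OF j] place(3)[OF n i j] by metis+
    have "a j * s n j + c j + 1 = Suc (val x j)"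
      unfolding a c div_mult_mod_eq by (rule Suc_eq_plus1[symmetric])
    then show ?thesis
      using Suc_val[OF x jn] node_val_in[OF x jn] by simp
  qed
  then have "map (\<lambda>j. min k (a j * s n j + c j + 1)) (children d h i) =
      map (node_val d h x) (children d h i)"
    by simp
  then have qry: "qry (n, a, c, y) =
      (if internal h i then FunVar i (map (node_val d h x) (children d h i)) else LeafVar i)"
    by (simp only: qry_def i option.case prod.case)
  show "x (qry (n, a, c, y)) = node_val d h x i"
    unfolding qry by (subst node_val.simps) (rule if_distrib)
  show "thrifty_query d h x (qry (n, a, c, y))"
    by (simp add: qry thrifty_query_def)
qed

text \<open>Every transition raises the level by one; this is why complete computations have length
  exactly \<open>t\<close>.\<close>

lemma run_fst:
  assumes "run x \<sigma> n" "i \<le> n"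
  shows "fst (\<sigma> i) = i"
  using assms(2)
proof (induction i)
  case (Suc i)
  then have "trans_rel (\<sigma> i) (x (qry (\<sigma> i))) (\<sigma> (Suc i))"
    using assms(1) by (simp add: run_def step_def)
  then show ?case
    using Suc by (simp add: trans_rel_def case_prod_beta)
qed (use assms in \<open>simp add: run_def\<close>)

lemma run_final:
  assumes "run x \<sigma> n"
  shows "n \<le> t" "\<sigma> n \<in> level t \<longleftrightarrow> n = t"
  using run_in_S[OF assms, of n] run_fst[OF assms, of n] final_iff[of "\<sigma> n"]
  by (auto simp: states_iff)

section \<open>Soundness of complete runs\<close>

context
  fixes x \<sigma>
  assumes x: "x \<in> inputs k (tree_vars d h k)" and run: "run x \<sigma> t"
begin

definition "A i = fst (snd (\<sigma> i))"
definition "C i = fst (snd (snd (\<sigma> i)))"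
definition "Y i = snd (snd (snd (\<sigma> i)))"

lemma \<sigma>_eq: "i \<le> t \<Longrightarrow> \<sigma> i = (i, A i, C i, Y i)"
  using run_fst[OF run, of i] by (simp add: A_def C_def Y_def prod_eq_iff)

lemma \<sigma>_level: "i \<le> t \<Longrightarrow> (i, A i, C i, Y i) \<in> level i"
  using run_in_S[OF run, of i] run_fst[OF run, of i] \<sigma>_eq[of i] by (simp add: states_iff)

lemma \<sigma>_trans:
  "i < t \<Longrightarrow>
   trans_rel (i, A i, C i, Y i) (x (qry (\<sigma> i))) (Suc i, A (Suc i), C (Suc i), Y (Suc i))"
  using run by (simp add: run_def step_def flip: \<sigma>_eq)

text \<open>
  Induction from the leaves upwards: once all assertions about the children are correct, a black
  assertion about \<open>j\<close> is correct from its placement onwards, and a white assertion about \<open>j\<close> is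
  correct since it survives until the query that checks it.
\<close>

lemma assertions_correct:
  assumes "j \<in> nodes d h" "i \<le> t"
  shows "A i j = val x j div s i j \<and> C i j = val x j mod m i j"
  using assms
proof (induction "h - length j" arbitrary: i j rule: less_induct)
  case less
  note j = \<open>j \<in> nodes d h\<close>
  \<comment> \<open>Children are longer lists, so the outer induction makes all assertions about
    them true at level \<open>n\<close>, including guesses not yet checked.\<close>
  have query: "x (qry (\<sigma> n)) - 1 = val x j" if "n < t" "pl n = Some j" for n
  proof -
    have "A n c = val x c div s n c \<and> C n c = val x c mod m n c" if "c \<in> set (children d h j)" for c
      using less.hyps[of c n] childrenD[OF j that] \<open>n < t\<close> by (auto simp: nodes_def)
    then show ?thesis
      using qry_correct(1)[OF x that, of "A n" "C n" "Y n"] \<sigma>_eq[of n] that by (simp add: val_def)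
  qed
  \<comment> \<open>Forward in time: at level 0 the only block has number 0; a placement records the
    true block, and any other move coarsens it.\<close>
  have "A i j = val x j div s i j"
    using \<open>i \<le> t\<close>
  proof (induction i)
    case 0
    then show ?case
      using \<sigma>_level[of 0] j val_le[OF x j] first(1)[OF j] k_pos by (auto simp: level_def PiE_iff)
  next
    case (Suc i)
    then show ?case
      using \<sigma>_trans[of i] j query[of i] refine(1)[of i j]
      by (cases "pl i = Some j") (auto simp: trans_rel_def div_mult_div dest!: bspec[OF _ j])
  qed
  \<comment> \<open>Backward in time: at level \<open>t\<close> the modulus is 1; a placement
    compares the guess with the answer, and otherwise the guess is the later one reduced modulo a
    divisor of the later modulus.\<close>
  moreover have "C i j = val x j mod m i j"
    using \<open>i \<le> t\<close>
  proof (induction rule: inc_induct)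
    case base
    then show ?case
      using \<sigma>_level[of t] j final(2)[OF j] by (auto simp: level_def PiE_iff)
  next
    case (step i)
    then show ?case
      using \<sigma>_trans[of i] j query[of i] refine(2)[of i j]
      by (cases "pl i = Some j") (auto simp: trans_rel_def mod_mod_cancel dest!: bspec[OF _ j])
  qed
  ultimately show ?case
    by blast
qed

lemma output_correct: "snd (snd (snd (\<sigma> t))) = G (node_val d h x [])"
proof -
  \<comment> \<open>The transition out of level \<open>n0\<close> fixes the output, and all later
    ones copy it.\<close>
  have "Y i = G (node_val d h x [])" if "i \<le> t" "Suc n0 \<le> i" for i
    using that(2,1)
  proof (induction rule: dec_induct)
    case base
    then show ?case
      using \<sigma>_trans[of n0] n0_less assertions_correct[of "[]" n0] root Suc_val[OF x, of "[]"]
      by (simp add: trans_rel_def)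
  next
    case (step i)
    then show ?case
      using \<sigma>_trans[of i] by (simp add: trans_rel_def)
  qed
  then show ?thesis
    using n0_less by (simp add: Y_def)
qed

text \<open>A complete run has passed all its checks, so the assertions about the children are true
  already when they are used. A query to the fixed leaf is thrifty by definition.\<close>

lemma thrifty_correct:
  assumes "i < t"
  shows "thrifty_query d h x (qry (\<sigma> i))"
proof (cases "pl i")
  case None
  then show ?thesis
    using \<sigma>_eq[of i] assms by (simp add: qry_def thrifty_query_def)
next
  case (Some j)
  have "c \<in> nodes d h" if "c \<in> set (children d h j)" for c
    using childrenD(1)[OF place(1)[OF assms Some] that] .
  then show ?thesis
    using qry_correct(2)[OF x assms Some, of "A i" "C i" "Y i"] \<sigma>_eq[of i] assms
      assertions_correct[of _ i] by simp
qed

end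

text \<open>Completeness: the run that records true blocks and guesses true residues at every level
  passes all checks.\<close>

lemma ex_run:
  assumes x: "x \<in> inputs k (tree_vars d h k)"
  shows "\<exists>\<sigma>. run x \<sigma> t"
proof
  let ?\<sigma> = "\<lambda>i. (i, (\<lambda>j\<in>nodes d h. val x j div s i j), (\<lambda>j\<in>nodes d h. val x j mod m i j),
     if i \<le> n0 then G 1 else G (node_val d h x []))"
  have lev: "?\<sigma> i \<in> level i" for i
    using val_le[OF x] m_pos[of i] G_in node_val_in[OF x, of "[]"]
    by (auto simp: level_def div_le_mono Suc_le_eq)
  have val0: "val x j < s 0 j" if "j \<in> nodes d h" for j
    using val_le[OF x that] first(1)[OF that] k_pos by simp
  show "run x ?\<sigma> t"
    unfolding run_def
  proof (intro conjI allI impI)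
    show "?\<sigma> 0 = start"
      using val0 first(2) by (auto simp: start_def fun_eq_iff)
    fix i
    assume i: "i < t"
    have query: "x (qry (?\<sigma> i)) - 1 = val x j" if "pl i = Some j" for j
      using qry_correct(1)[OF x i that, of "\<lambda>j\<in>nodes d h. val x j div s i j"
          "\<lambda>j\<in>nodes d h. val x j mod m i j"] childrenD(1)[OF place(1)[OF i that]]
      by (simp add: val_def)
    have "trans_rel (?\<sigma> i) (x (qry (?\<sigma> i))) (?\<sigma> (Suc i))"
      unfolding trans_rel_def
      using query place(2)[OF i] refine[OF i] root Suc_val[OF x, of "[]"]
      by (auto simp: div_mult_div mod_mod_cancel)
    then show "step x (?\<sigma> i) (?\<sigma> (Suc i))"
      unfolding step_def using lev[of i] lev[of "Suc i"] i by (auto simp: states_iff dest: fst_level)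
  qed
qed

lemma computes: "computes k (tree_vars d h k) R (\<lambda>x. G (node_val d h x [])) prog"
proof (rule computes_prog)
  fix x \<sigma> n
  assume x: "x \<in> inputs k (tree_vars d h k)" and r: "run x \<sigma> n" "\<sigma> n \<in> level t"
  then have "n = t"
    using run_final by blast
  then show "snd (snd (snd (\<sigma> n))) = G (node_val d h x [])"
    using output_correct[OF x] r by simp
next
  fix x
  assume x: "x \<in> inputs k (tree_vars d h k)"
  then show "\<exists>\<sigma> n. run x \<sigma> n \<and> \<sigma> n \<in> level t"
    using ex_run run_final by blast
qed

lemma nondet_thrifty: "nondet_thrifty d h k prog"
  unfolding nondet_thrifty_def
proof (intro ballI allI impI)
  fix x p u v
  assume x: "x \<in> inputs k (tree_vars d h k)"
    and w: "u \<in> bp_final prog" "bp_walk prog x p u"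
    and v: "v \<in> set (pre_digraph.awalk_verts (bp_graph prog) (bp_root prog) p) - bp_final prog"
  have "thrifty_query d h x (qry (\<sigma> i))" if "run x \<sigma> n" "\<sigma> n \<in> level t" "i < n" for \<sigma> n i
  proof -
    have "n = t"
      using run_final that by blast
    then show ?thesis
      using thrifty_correct[OF x] that by blast
  qed
  then show "thrifty_query d h x (bp_query prog v)"
    by (rule thrifty_prog[where thrifty = "thrifty_query d h x", OF _ x w(2,1) v])
qed

section \<open>Determinism in the absence of white pebbles\<close>

context
  assumes no_white: "\<And>n j. m n j = 1"
begin

text \<open>With all moduli 1 the guesses are constantly 0, so no check fails and nothing is left to
  choose.\<close>

lemma ex1_trans:
  assumes u: "u \<in> states - level t" and l: "l \<in> {1..k}"
  shows "\<exists>!u'. u' \<in> states \<and> trans_rel u l u'"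
proof -
  obtain n a c y where u_eq: "u = (n, a, c, y)"
    by (cases u)
  have n: "n < t" and lev: "(n, a, c, y) \<in> level n"
    using nonfinal[OF u] by (simp_all add: u_eq)
  have a: "a j \<le> (k - 1) div s n j" and c: "c j = 0" if "j \<in> nodes d h" for j
    using lev that no_white by (auto simp: level_def PiE_iff)
  \<comment> \<open>Unreachable states need successors as well, so the output must lie in
    \<open>R\<close> for every admissible \<open>a []\<close>, not only for the true root
    value.\<close>
  have G_a: "G (Suc (a [])) \<in> R" if "n = n0"
    using a[of "[]"] that root k_pos by (intro G_in) auto
  define u' where "u' = (Suc n,
      (\<lambda>j\<in>nodes d h. if pl n = Some j then (l - 1) div s (Suc n) j else a j * s n j div s (Suc n) j),
      (\<lambda>j\<in>nodes d h. 0 :: nat), if n = n0 then G (a [] + 1) else y)"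
  \<comment> \<open>The recorded block starts at an element at most \<open>k - 1\<close>, so the
    coarser block number is in range.\<close>
  have bound: "a j * s n j div s (Suc n) j \<le> (k - 1) div s (Suc n) j" if "j \<in> nodes d h" for j
  proof -
    have "a j * s n j \<le> (k - 1) div s n j * s n j"
      using a[OF that] by simp
    also have "\<dots> \<le> k - 1"
      by (rule div_times_less_eq_dividend)
    finally show ?thesis
      by (rule div_le_mono)
  qed
  have "u' \<in> states"
    using n bound l G_a lev no_white
    by (auto simp: states_iff level_def u'_def div_le_mono split: if_splits)
  moreover have "trans_rel u l u'"
    using c no_white by (auto simp: trans_rel_def u_eq u'_def)
  moreover have "u'' = u'" if u'': "u'' \<in> states" "trans_rel u l u''" for u''
  proof -
    obtain n' a' c' y' where eq: "u'' = (n', a', c', y')"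
      by (cases u'')
    have n': "n' = Suc n" and y': "y' = (if n = n0 then G (a [] + 1) else y)"
      using u''(2) by (auto simp: trans_rel_def u_eq eq)
    have ext: "a' \<in> extensional (nodes d h)" "c' \<in> extensional (nodes d h)"
      using u''(1) by (auto simp: states_iff eq level_def PiE_iff)
    have "c' j = 0" if "j \<in> nodes d h" for j
      using u''(1) that no_white by (auto simp: states_iff eq level_def PiE_iff)
    then have "c' = (\<lambda>j\<in>nodes d h. 0)"
      by (intro extensionalityI[OF ext(2)]) auto
    moreover have "a' = (\<lambda>j\<in>nodes d h. if pl n = Some j then (l - 1) div s (Suc n) j
        else a j * s n j div s (Suc n) j)"
      by (intro extensionalityI[OF ext(1)])
        (use u''(2) in \<open>auto simp: trans_rel_def u_eq eq n' split: if_splits\<close>)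
    ultimately show ?thesis
      by (simp add: eq n' y' u'_def)
  qed
  ultimately show ?thesis
    by blast
qed

lemma deterministic: "deterministic k prog"
  by (intro deterministic_prog ex1_trans)

text \<open>Deterministic thriftiness concerns every reachable state, whereas
  \<open>thrifty_correct\<close> concerns complete runs. As no state before level \<open>t\<close>
  is stuck, every partial run extends to a complete one.\<close>

lemma run_extend:
  assumes x: "x \<in> inputs k (tree_vars d h k)" and "n \<le> t" "run x \<sigma> n"
  shows "\<exists>\<sigma>'. run x \<sigma>' t \<and> (\<forall>i\<le>n. \<sigma>' i = \<sigma> i)"
  using assms(2,3)
proof (induction arbitrary: \<sigma> rule: inc_induct)
  case (step n)
  have sn: "\<sigma> n \<in> states - level t"
    using run_in_S[OF step.prems, of n] run_final(2)[OF step.prems] step.hyps by auto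
  have "x (qry (\<sigma> n)) \<in> {1..k}"
    using qry_in[OF sn] x by (auto simp: inputs_def)
  then obtain u where u: "u \<in> states" "trans_rel (\<sigma> n) (x (qry (\<sigma> n))) u"
    using ex1_trans[OF sn] by blast
  have "run x (\<sigma>(Suc n := u)) (Suc n)"
    using step.prems u sn by (auto simp: run_def step_def less_Suc_eq)
  from step.IH[OF this] show ?case
    by (metis Suc_n_not_le_n fun_upd_other le_SucI)
qed auto

lemma det_thrifty: "det_thrifty d h k prog"
  unfolding det_thrifty_def
proof (intro ballI allI impI)
  fix x p u
  assume x: "x \<in> inputs k (tree_vars d h k)" and u: "u \<in> bp_states prog - bp_final prog"
    and w: "bp_walk prog x p u"
  obtain \<sigma> where \<sigma>: "run x \<sigma> (length p)" "enc (\<sigma> (length p)) = u"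
    using walk_imp_run[OF x w] by blast
  have "\<sigma> (length p) \<notin> level t"
    using u by (auto simp flip: \<sigma>(2))
  then have "length p < t"
    using run_final[OF \<sigma>(1)] by auto
  moreover obtain \<sigma>' where "run x \<sigma>' t" "\<sigma>' (length p) = \<sigma> (length p)"
    using run_extend[OF x _ \<sigma>(1)] run_final(1)[OF \<sigma>(1)] by blast
  ultimately have "thrifty_query d h x (qry (\<sigma> (length p)))"
    using thrifty_correct[OF x] by metis
  then show "thrifty_query d h x (bp_query prog u)"
    using run_in_S[OF \<sigma>(1)] by (simp flip: \<sigma>(2))
qed

end

end

section \<open>Rounding a fractional pebbling\<close>

text \<open>For \<open>k \<ge> 1\<close> and \<open>z \<ge> 0\<close> this is the least power of 2
  that is at least \<open>k powr z\<close>. Unlike other roundings it turns comparison of exponents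
  into divisibility.\<close>

definition pow2ceil :: "nat \<Rightarrow> real \<Rightarrow> nat" where
  "pow2ceil k z = 2 ^ nat \<lceil>z * log 2 (real k)\<rceil>"

lemma pow2ceil_0 [simp]: "pow2ceil k 0 = 1"
  by (simp add: pow2ceil_def)

lemma pow2ceil_pos: "pow2ceil k z \<ge> 1"
  by (simp add: pow2ceil_def)

lemma pow2ceil_eq_powr: "real (pow2ceil k z) = 2 powr real (nat \<lceil>z * log 2 (real k)\<rceil>)"
  by (simp add: pow2ceil_def powr_realpow)

lemma powr_eq_2_powr:
  assumes "k \<ge> 1"
  shows "real k powr z = 2 powr (z * log 2 (real k))"
  using assms by (subst mult.commute, subst powr_powr[symmetric]) simp

lemma powr_le_pow2ceil: "k \<ge> 1 \<Longrightarrow> real k powr z \<le> real (pow2ceil k z)"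
  by (simp add: pow2ceil_eq_powr powr_eq_2_powr) linarith

text \<open>Rounding up the exponent of 2 adds at most 1, hence costs at most a factor 2.\<close>

lemma pow2ceil_le_powr:
  assumes "k \<ge> 1" "z \<ge> 0"
  shows "real (pow2ceil k z) \<le> 2 * real k powr z"
proof -
  have "0 \<le> z * log 2 (real k)"
    using assms by simp
  then have "real (nat \<lceil>z * log 2 (real k)\<rceil>) \<le> 1 + z * log 2 (real k)"
    by linarith
  then have "real (pow2ceil k z) \<le> 2 powr (1 + z * log 2 (real k))"
    by (simp add: pow2ceil_eq_powr)
  also have "\<dots> = 2 * real k powr z"
    using assms by (simp add: powr_add powr_eq_2_powr)
  finally show ?thesis .
qed

lemma pow2ceil_dvd:
  assumes "k \<ge> 1" "z \<le> z'"
  shows "pow2ceil k z dvd pow2ceil k z'"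
  unfolding pow2ceil_def
  using assms by (intro le_imp_power_dvd nat_mono ceiling_mono mult_right_mono) auto

lemma le_pow2ceil_1: "k \<ge> 1 \<Longrightarrow> k \<le> pow2ceil k 1"
  using powr_le_pow2ceil[of k 1] by simp

text \<open>Beyond the first block there are at most \<open>k / k powr (1 - b) = k powr b\<close>
  others, and the extra 1 is absorbed by \<open>k powr b \<ge> 1\<close>.\<close>

lemma card_black_le:
  assumes "k \<ge> 1" "b \<ge> 0"
  shows "real (Suc ((k - 1) div pow2ceil k (1 - b))) \<le> 2 * real k powr b"
proof -
  have "real ((k - 1) div pow2ceil k (1 - b)) \<le> real (k - 1) / real (pow2ceil k (1 - b))"
    by (rule of_nat_div_le_of_nat)
  also have "\<dots> \<le> real k / real k powr (1 - b)"
    using assms powr_le_pow2ceil[of k "1 - b"] by (intro frac_le) auto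
  also have "\<dots> = real k powr b"
    using assms by (simp add: powr_diff)
  finally show ?thesis
    using ge_one_powr_ge_zero[of "real k" b] assms by simp
qed

text \<open>Each node contributes a factor of at most 2 for its blocks and 2 for its residues, times
  \<open>k\<close> to its pebble value; the exponents add up to the number of pebbles.\<close>

lemma card_config_le:
  assumes k: "k \<ge> 1" and valid: "valid_config d h (b, w)" and p: "pebbles d h (b, w) \<le> p"
  shows "real ((\<Prod>j\<in>nodes d h. Suc ((k - 1) div pow2ceil k (1 - b j))) * (\<Prod>j\<in>nodes d h. pow2ceil k (w j)))
    \<le> 4 ^ card (nodes d h) * real k powr p"
proof -
  have bw: "0 \<le> b j" "0 \<le> w j" if "j \<in> nodes d h" for j
    using valid that by (auto simp: valid_config_def)
  have "real ((\<Prod>j\<in>nodes d h. Suc ((k - 1) div pow2ceil k (1 - b j))) * (\<Prod>j\<in>nodes d h. pow2ceil k (w j)))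
      = (\<Prod>j\<in>nodes d h. real (Suc ((k - 1) div pow2ceil k (1 - b j))) * real (pow2ceil k (w j)))"
    by (simp add: prod.distrib)
  also have "\<dots> \<le> (\<Prod>j\<in>nodes d h. 4 * real k powr (b j + w j))"
  proof (intro prod_mono conjI)
    fix j
    assume j: "j \<in> nodes d h"
    have "real (Suc ((k - 1) div pow2ceil k (1 - b j))) * real (pow2ceil k (w j)) \<le>
        (2 * real k powr b j) * (2 * real k powr w j)"
      using card_black_le[OF k bw(1)[OF j]] pow2ceil_le_powr[OF k bw(2)[OF j]] by (intro mult_mono) auto
    then show "real (Suc ((k - 1) div pow2ceil k (1 - b j))) * real (pow2ceil k (w j)) \<le>
        4 * real k powr (b j + w j)"
      by (simp add: powr_add)
  qed simp
  also have "\<dots> = 4 ^ card (nodes d h) * real k powr pebbles d h (b, w)"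
    using k by (simp add: prod.distrib powr_sum pebbles_def)
  also have "\<dots> \<le> 4 ^ card (nodes d h) * real k powr p"
    using k p by (intro mult_left_mono powr_mono) auto
  finally show ?thesis .
qed

text \<open>What the programs need from a move: away from the placed node, black only falls and
  white only rises, which means coarser blocks and finer guesses. The children of the placed node
  fall under this as well.\<close>

lemma pebble_moveE:
  assumes "pebble_move d h D D'"
  obtains pl where
    "\<And>j. j \<in> nodes d h \<Longrightarrow> pl \<noteq> Some j \<Longrightarrow> fst D' j \<le> fst D j \<and> snd D j \<le> snd D' j"
    "\<And>i. pl = Some i \<Longrightarrow> i \<in> nodes d h \<and> snd D' i = 0 \<and>
      (\<forall>c \<in> set (children d h i). fst D c + snd D c = 1)"
  using assms
proof cases
  case (decrease_black i r b w)
  then show ?thesis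
    by (intro that[of None]) auto
next
  case (increase_white i w r b)
  then show ?thesis
    by (intro that[of None]) auto
next
  case (place_black i b w b')
  have "b' j \<le> b j" if "j \<noteq> i" for j
    using place_black(6,7)[of j] that by (cases "j \<in> set (children d h i)") auto
  then show ?thesis
    using place_black by (intro that[of "Some i"]) auto
qed

lemma pebbling_placements:
  assumes "\<forall>n<t. pebble_move d h (C n) (C (Suc n))"
  obtains pl where
    "\<And>n j. n < t \<Longrightarrow> j \<in> nodes d h \<Longrightarrow> pl n \<noteq> Some j \<Longrightarrow>
      fst (C (Suc n)) j \<le> fst (C n) j \<and> snd (C n) j \<le> snd (C (Suc n)) j"
    "\<And>n i. n < t \<Longrightarrow> pl n = Some i \<Longrightarrow> i \<in> nodes d h \<and> snd (C (Suc n)) i = 0 \<and>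
      (\<forall>c \<in> set (children d h i). fst (C n) c + snd (C n) c = 1)"
proof -
  let ?P = "\<lambda>n pl. (\<forall>j \<in> nodes d h. pl \<noteq> Some j \<longrightarrow>
        fst (C (Suc n)) j \<le> fst (C n) j \<and> snd (C n) j \<le> snd (C (Suc n)) j) \<and>
      (\<forall>i. pl = Some i \<longrightarrow> i \<in> nodes d h \<and> snd (C (Suc n)) i = 0 \<and>
        (\<forall>c \<in> set (children d h i). fst (C n) c + snd (C n) c = 1))"
  have "\<exists>pl. ?P n pl" if n: "n < t" for n
  proof -
    have "pebble_move d h (C n) (C (Suc n))"
      using assms n by blast
    then show ?thesis
      by (rule pebble_moveE) blast
  qed
  then obtain pl where "\<forall>n<t. ?P n (pl n)"
    by metis
  then show ?thesis
    by (intro that[of pl]) blast+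
qed

text \<open>Since \<open>M\<close> is fixed before \<open>k\<close>, choosing one program for each
  \<open>k\<close> turns the individual bounds into an asymptotic one.\<close>

lemma programs_with_few_states:
  assumes "\<And>k. k \<ge> 1 \<Longrightarrow> \<exists>B. P k B \<and> real (card (bp_states B)) \<le> M * real k powr p"
  shows "\<exists>B. (\<forall>k\<ge>1. P k (B k)) \<and> (\<lambda>k. real (card (bp_states (B k)))) \<in> O(\<lambda>k. real k powr p)"
proof -
  obtain B where B: "\<And>k. k \<ge> 1 \<Longrightarrow> P k (B k) \<and> real (card (bp_states (B k))) \<le> M * real k powr p"
    using assms by metis
  then have "(\<lambda>k. real (card (bp_states (B k)))) \<in> O(\<lambda>k. real k powr p)"
    by (intro bigoI[of _ M] eventually_at_top_linorderI[of 1]) simp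
  then show ?thesis
    using B by blast
qed

text \<open>Neither the tree nor the length \<open>t\<close> depends on \<open>k\<close>, so summing
  the bound for one configuration over all levels changes only the constant.\<close>

lemma fractional_pebbling_programs:
  assumes dh: "d \<ge> 1" "h \<ge> 1" and C: "fractional_pebbling d h p t C"
  shows "\<exists>B :: nat \<Rightarrow> (nat, nat, tree_var, bool) bprog.
     (\<forall>k\<ge>1. computes k (tree_vars d h k) UNIV (BT d h) (B k) \<and> nondet_thrifty d h k (B k)) \<and>
     (\<lambda>k. real (card (bp_states (B k)))) \<in> O(\<lambda>k. real k powr p)"
proof (rule programs_with_few_states)
  obtain n0 where n0: "n0 \<le> t" "fst (C n0) [] = 1"
    using C by (auto simp: fractional_pebbling_def)
  have empty: "fst (C 0) j = 0 \<and> snd (C 0) j = 0" "fst (C t) j = 0 \<and> snd (C t) j = 0"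
    if "j \<in> nodes d h" for j
    using C that by (auto simp: fractional_pebbling_def empty_config_def case_prod_beta)
  have "[] \<in> nodes d h"
    using dh by (simp add: nodes_def)
  \<comment> \<open>The root has black value 1 at \<open>n0\<close> but 0 at
    \<open>t\<close>.\<close>
  then have "n0 < t"
    using n0 empty(2)[of "[]"] by (cases "n0 = t") auto
  have moves: "\<forall>n<t. pebble_move d h (C n) (C (Suc n))"
    using C by (simp add: fractional_pebbling_def)
  obtain pl where pl: "\<And>n j. n < t \<Longrightarrow> j \<in> nodes d h \<Longrightarrow> pl n \<noteq> Some j \<Longrightarrow>
      fst (C (Suc n)) j \<le> fst (C n) j \<and> snd (C n) j \<le> snd (C (Suc n)) j"
    "\<And>n i. n < t \<Longrightarrow> pl n = Some i \<Longrightarrow> i \<in> nodes d h \<and> snd (C (Suc n)) i = 0 \<and>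
      (\<forall>c \<in> set (children d h i). fst (C n) c + snd (C n) c = 1)"
    by (rule pebbling_placements[OF moves], rule that)
  fix k :: nat
  assume k: "k \<ge> 1"
  \<comment> \<open>Blocks use exponent \<open>1 - b\<close> and moduli exponent \<open>w\<close>,
    through the same rounding; the two agree exactly when \<open>b + w = 1\<close>.\<close>
  interpret discrete_pebbling d h k t n0
    "\<lambda>n j. pow2ceil k (1 - fst (C n) j)" "\<lambda>n j. pow2ceil k (snd (C n) j)" pl UNIV "\<lambda>v. v = 1"
  proof
    show "k \<le> pow2ceil k (1 - fst (C 0) j)" "k \<le> pow2ceil k (1 - fst (C t) j)"
      "pow2ceil k (snd (C 0) j) = 1" "pow2ceil k (snd (C t) j) = 1" if "j \<in> nodes d h" for j
      using empty[OF that] le_pow2ceil_1[OF k] by simp_all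
    show "pow2ceil k (1 - fst (C n) j) dvd pow2ceil k (1 - fst (C (Suc n)) j)"
      "pow2ceil k (snd (C n) j) dvd pow2ceil k (snd (C (Suc n)) j)"
      if "n < t" "j \<in> nodes d h" "pl n \<noteq> Some j" for n j
      using pl(1)[OF that] by (simp_all add: pow2ceil_dvd[OF k])
    show "pow2ceil k (1 - fst (C n) c) = pow2ceil k (snd (C n) c)"
      if "n < t" "pl n = Some i" "c \<in> set (children d h i)" for n i c
    proof -
      have "1 - fst (C n) c = snd (C n) c"
        using pl(2)[OF that(1,2)] that(3) by (simp add: algebra_simps)
      then show ?thesis
        by simp
    qed
    show "i \<in> nodes d h" "pow2ceil k (snd (C (Suc n)) i) = 1" if "n < t" "pl n = Some i" for n i
      using pl(2)[OF that] by simp_all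
  qed (use dh k \<open>n0 < t\<close> n0(2) pow2ceil_pos in auto)
  have "real (card (level n)) \<le> 2 * 4 ^ card (nodes d h) * real k powr p" if "n \<le> t" for n
  proof -
    let ?N = "(\<Prod>j\<in>nodes d h. Suc ((k - 1) div pow2ceil k (1 - fst (C n) j))) *
      (\<Prod>j\<in>nodes d h. pow2ceil k (snd (C n) j))"
    \<comment> \<open>The output component has at most two values.\<close>
    have "card (level n) \<le> 2 * ?N"
      unfolding card_level by simp
    then have "real (card (level n)) \<le> 2 * real ?N"
      unfolding of_nat_le_iff[where 'a = real, symmetric] by simp
    also have "real ?N \<le> 4 ^ card (nodes d h) * real k powr p"
      using card_config_le[OF k, of d h "fst (C n)" "snd (C n)" p] C that
      by (simp add: fractional_pebbling_def)
    finally show ?thesis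
      by simp
  qed
  then have "(\<Sum>n\<le>t. real (card (level n))) \<le> (\<Sum>n\<le>t. 2 * 4 ^ card (nodes d h) * real k powr p)"
    by (intro sum_mono) simp
  moreover have "real (card states) \<le> (\<Sum>n\<le>t. real (card (level n)))"
    using card_states unfolding of_nat_sum[symmetric] of_nat_le_iff .
  ultimately have "real (card (bp_states prog)) \<le>
      (real (Suc t) * 2 * 4 ^ card (nodes d h)) * real k powr p"
    unfolding card_prog by (simp add: algebra_simps)
  moreover have "BT d h = (\<lambda>x. node_val d h x [] = 1)"
    by (simp add: fun_eq_iff BT_def)
  ultimately show "\<exists>B :: (nat, nat, tree_var, bool) bprog.
      (computes k (tree_vars d h k) UNIV (BT d h) B \<and> nondet_thrifty d h k B) \<and>
      real (card (bp_states B)) \<le> (real (Suc t) * 2 * 4 ^ card (nodes d h)) * real k powr p"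
    using computes nondet_thrifty by auto
qed

text \<open>
  The pebbling is cut off once the root is pebbled, and its value is output at once: a deterministic
  program that remembered the value of the root to the end could need too many states.
\<close>

lemma black_pebbling_programs:
  fixes R :: "nat \<Rightarrow> 'r set" and G :: "nat \<Rightarrow> 'r"
  assumes dh: "d \<ge> 1" "h \<ge> 1" and black: "black_pebbling d h p t C"
    and R: "\<And>k. k \<ge> 1 \<Longrightarrow> finite (R k) \<and> G ` {1..k} \<subseteq> R k \<and> card (R k) \<le> 2 * k"
  shows "\<exists>B :: nat \<Rightarrow> (nat, nat, tree_var, 'r) bprog.
     (\<forall>k\<ge>1. computes k (tree_vars d h k) (R k) (\<lambda>x. G (node_val d h x [])) (B k) \<and>
        deterministic k (B k) \<and> det_thrifty d h k (B k)) \<and>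
     (\<lambda>k. real (card (bp_states (B k)))) \<in> O(\<lambda>k. real k powr p)"
proof (rule programs_with_few_states)
  have C: "fractional_pebbling d h p t C"
    and b01: "\<And>n i. n \<le> t \<Longrightarrow> i \<in> nodes d h \<Longrightarrow> snd (C n) i = 0 \<and> fst (C n) i \<in> {0, 1}"
    using black by (auto simp: black_pebbling_def)
  obtain n0 where n0: "n0 \<le> t" "fst (C n0) [] = 1"
    using C by (auto simp: fractional_pebbling_def)
  have empty: "fst (C 0) j = 0" if "j \<in> nodes d h" for j
    using C that by (auto simp: fractional_pebbling_def empty_config_def case_prod_beta)
  have "[] \<in> nodes d h"
    using dh by (simp add: nodes_def)
  \<comment> \<open>The pebble on the root gives \<open>p \<ge> 1\<close>, so the up to
    \<open>2 * k\<close> output states stay within the bound.\<close>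
  then have "1 \<le> pebbles d h (C n0)"
    using n0 b01[OF n0(1)] member_le_sum[of "[]" "nodes d h" "\<lambda>i. fst (C n0) i + snd (C n0) i"]
    by (force simp: pebbles_def case_prod_beta)
  also have "\<dots> \<le> p"
    using C n0 by (simp add: fractional_pebbling_def)
  finally have p: "1 \<le> p" .
  have moves: "\<forall>n<t. pebble_move d h (C n) (C (Suc n))"
    using C by (simp add: fractional_pebbling_def)
  obtain pl where pl: "\<And>n j. n < t \<Longrightarrow> j \<in> nodes d h \<Longrightarrow> pl n \<noteq> Some j \<Longrightarrow>
      fst (C (Suc n)) j \<le> fst (C n) j \<and> snd (C n) j \<le> snd (C (Suc n)) j"
    "\<And>n i. n < t \<Longrightarrow> pl n = Some i \<Longrightarrow> i \<in> nodes d h \<and> snd (C (Suc n)) i = 0 \<and>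
      (\<forall>c \<in> set (children d h i). fst (C n) c + snd (C n) c = 1)"
    by (rule pebbling_placements[OF moves], rule that)
  fix k :: nat
  assume k: "k \<ge> 1"
  \<comment> \<open>Level \<open>Suc n0\<close> has a single block per node and so stores only the
    output.\<close>
  define s where "s n j = (if n \<le> n0 then pow2ceil k (1 - fst (C n) j) else pow2ceil k 1)" for n j
  \<comment> \<open>The added transition out of level \<open>n0\<close> places nothing and only
    coarsens, as \<open>1 - b \<le> 1\<close>.\<close>
  have s_dvd: "s n j dvd s (Suc n) j"
    if "n < Suc n0" "j \<in> nodes d h" "(if n < n0 then pl n else None) \<noteq> Some j" for n j
  proof (cases "n = n0")
    case True
    then show ?thesis
      using b01[of n j] that n0 k by (auto simp: s_def intro!: pow2ceil_dvd)
  next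
    case False
    then show ?thesis
      using pl(1)[of n j] that n0 k by (auto simp: s_def intro!: pow2ceil_dvd)
  qed
  \<comment> \<open>Without white pebbles, full children have black value 1 and hence blocks of size
    1, matching the constant modulus 1.\<close>
  have s_child: "s n c = 1" if "n < n0" "pl n = Some i" "c \<in> set (children d h i)" for n i c
    using pl(2)[of n i] b01[of n c] childrenD(1)[of i d h c] that n0 by (auto simp: s_def)
  interpret discrete_pebbling d h k "Suc n0" n0 s "\<lambda>_ _. 1" "\<lambda>n. if n < n0 then pl n else None"
    "R k" G
  proof
    show "k \<le> s 0 j" "k \<le> s (Suc n0) j" if "j \<in> nodes d h" for j
      using empty[OF that] le_pow2ceil_1[OF k] by (simp_all add: s_def)
    show "i \<in> nodes d h" if "n < Suc n0" "(if n < n0 then pl n else None) = Some i" for n i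
      using pl(2)[of n i] that n0 by (auto split: if_splits)
    show "s n c = 1" if "n < Suc n0" "(if n < n0 then pl n else None) = Some i"
      "c \<in> set (children d h i)" for n i c
      using s_child[of n i c] that by (auto split: if_splits)
    show "s n0 [] = 1"
      using n0 by (simp add: s_def)
    show "s n j dvd s (Suc n) j" if "n < Suc n0" "j \<in> nodes d h"
      "(if n < n0 then pl n else None) \<noteq> Some j" for n j
      by (rule s_dvd[OF that])
  qed (use dh k R[OF k] in auto)
  have level: "real (card (level n)) \<le> 4 ^ card (nodes d h) * real k powr p" if n: "n \<le> n0" for n
  proof -
    have "(\<Prod>j\<in>nodes d h. pow2ceil k (snd (C n) j)) = 1"
      using b01[of n] n n0 by simp
    then show ?thesis
      unfolding card_level
      using card_config_le[OF k, of d h "fst (C n)" "snd (C n)" p] C n n0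
      by (simp add: fractional_pebbling_def s_def)
  qed
  \<comment> \<open>The factor 2 accommodates the two Boolean outputs when
    \<open>k = 1\<close>.\<close>
  have "real (card (level (Suc n0))) \<le> 2 * real k"
    unfolding card_level using R[OF k] k_div(2) by simp
  also have "\<dots> \<le> 2 * real k powr p"
    using powr_mono[of 1 p "real k"] p k by simp
  finally have "(\<Sum>n\<le>Suc n0. real (card (level n)))
      \<le> (\<Sum>n\<le>n0. 4 ^ card (nodes d h) * real k powr p) + 2 * real k powr p"
    unfolding sum.atMost_Suc by (intro add_mono sum_mono level) auto
  moreover have "real (card states) \<le> (\<Sum>n\<le>Suc n0. real (card (level n)))"
    using card_states unfolding of_nat_sum[symmetric] of_nat_le_iff .
  ultimately have "real (card (bp_states prog)) \<le>
      (real (Suc n0) * 4 ^ card (nodes d h) + 2) * real k powr p"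
    unfolding card_prog by (simp add: algebra_simps)
  \<comment> \<open>The constant must be independent of \<open>n0\<close>, which was obtained only
    inside this proof.\<close>
  also have "\<dots> \<le> (real (Suc t) * 4 ^ card (nodes d h) + 2) * real k powr p"
    using n0(1) by (intro mult_right_mono add_right_mono) auto
  finally show "\<exists>B :: (nat, nat, tree_var, 'r) bprog.
      (computes k (tree_vars d h k) (R k) (\<lambda>x. G (node_val d h x [])) B \<and>
        deterministic k B \<and> det_thrifty d h k B) \<and>
      real (card (bp_states B)) \<le> (real (Suc t) * 4 ^ card (nodes d h) + 2) * real k powr p"
    using computes deterministic det_thrifty by blast
qed

theorem theorem3p4:
  fixes d h :: nat and p :: real
  assumes "d \<ge> 2" and "h \<ge> 2"
  shows
    "((\<exists>t C. black_pebbling d h p t C) \<longrightarrow>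
        (\<exists>B :: nat \<Rightarrow> (nat, nat, tree_var, nat) bprog.
           (\<forall>k\<ge>1. computes k (tree_vars d h k) {1..k} (FT d h) (B k) \<and>
                  deterministic k (B k) \<and> det_thrifty d h k (B k)) \<and>
           (\<lambda>k. real (card (bp_states (B k)))) \<in> O(\<lambda>k. real k powr p)) \<and>
        (\<exists>B :: nat \<Rightarrow> (nat, nat, tree_var, bool) bprog.
           (\<forall>k\<ge>1. computes k (tree_vars d h k) UNIV (BT d h) (B k) \<and>
                  deterministic k (B k) \<and> det_thrifty d h k (B k)) \<and>
           (\<lambda>k. real (card (bp_states (B k)))) \<in> O(\<lambda>k. real k powr p)))
     \<and>
     ((\<exists>t C. fractional_pebbling d h p t C) \<longrightarrow>
        (\<exists>B :: nat \<Rightarrow> (nat, nat, tree_var, bool) bprog.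
           (\<forall>k\<ge>1. computes k (tree_vars d h k) UNIV (BT d h) (B k) \<and>
                  nondet_thrifty d h k (B k)) \<and>
           (\<lambda>k. real (card (bp_states (B k)))) \<in> O(\<lambda>k. real k powr p)))"
proof -
  have dh: "d \<ge> 1" "h \<ge> 1"
    using assms by auto
  have FT: "FT d h = (\<lambda>x. id (node_val d h x []))"
    by (simp add: fun_eq_iff FT_def)
  have BT: "BT d h = (\<lambda>x. node_val d h x [] = 1)"
    by (simp add: fun_eq_iff BT_def)
  show ?thesis
  proof (intro conjI impI; elim exE)
    fix t C
    assume C: "black_pebbling d h p t C"
    show "\<exists>B :: nat \<Rightarrow> (nat, nat, tree_var, nat) bprog.
       (\<forall>k\<ge>1. computes k (tree_vars d h k) {1..k} (FT d h) (B k) \<and>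
          deterministic k (B k) \<and> det_thrifty d h k (B k)) \<and>
       (\<lambda>k. real (card (bp_states (B k)))) \<in> O(\<lambda>k. real k powr p)"
      unfolding FT by (rule black_pebbling_programs[OF dh C]) auto
    show "\<exists>B :: nat \<Rightarrow> (nat, nat, tree_var, bool) bprog.
       (\<forall>k\<ge>1. computes k (tree_vars d h k) UNIV (BT d h) (B k) \<and>
          deterministic k (B k) \<and> det_thrifty d h k (B k)) \<and>
       (\<lambda>k. real (card (bp_states (B k)))) \<in> O(\<lambda>k. real k powr p)"
      unfolding BT by (rule black_pebbling_programs[OF dh C]) auto
  next
    fix t C
    assume "fractional_pebbling d h p t C"
    then show "\<exists>B :: nat \<Rightarrow> (nat, nat, tree_var, bool) bprog.
       (\<forall>k\<ge>1. computes k (tree_vars d h k) UNIV (BT d h) (B k) \<and> nondet_thrifty d h k (B k)) \<and>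
       (\<lambda>k. real (card (bp_states (B k)))) \<in> O(\<lambda>k. real k powr p)"
      by (rule fractional_pebbling_programs[OF dh])
  qed
qed

end
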